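(* Let $X$ be a completely regular Baire space with the $L$-property. Then $c(X)=d(X)$.
   Context: A function $f:X\times Y\to\mathbb R$ on a product of topological spaces is separately continuous if it is continuous in each variable when the other is fixed. A function $f:Z\to\mathbb R$ on a topological space $Z$ is a first Lebesgue class function if $f^{-1}(G)$ is an $F_\sigma$-set in $Z$ (a countable union of closed sets) for every open set $G\subseteq\mathbb R$. A topological space $X$ has the $L$-property if for every topological space $Y$ each separately continuous function $f:X\times Y\to\mathbb R$ is a first Lebesgue class function on $X\times Y$ (with the product topology). $c(X)$ (the Souslin number of $X$) is the minimal cardinal $\aleph\ge\aleph_0$ such that every system of pairwise disjoint open sets in $X$ has cardinality at most $\aleph$. $d(X)$ is the density of $X$, with the convention that it is infinite: the minimal cardinal $\aleph\ge\aleph_0$ such that $X$ has a dense subset of cardinality at most $\aleph$. A Baire space is a topological space in which every countable intersection of dense open sets is dense. *)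

theory Defs
  imports "HOL-Analysis.Analysis"
begin

unbundle cardinal_syntax

no_notation elt_set_eq (infix "=o" 50)

section \<open>Separate continuity and the first Lebesgue class\<close>

definition separately_continuous ::
    "'a topology \<Rightarrow> 'b topology \<Rightarrow> ('a \<times> 'b \<Rightarrow> real) \<Rightarrow> bool" where
  "separately_continuous X Y f \<longleftrightarrow>
     (\<forall>x \<in> topspace X. continuous_map Y euclideanreal (\<lambda>y. f (x, y))) \<and>
     (\<forall>y \<in> topspace Y. continuous_map X euclideanreal (\<lambda>x. f (x, y)))"

definition first_Lebesgue_class :: "'c topology \<Rightarrow> ('c \<Rightarrow> real) \<Rightarrow> bool" where
  "first_Lebesgue_class Z f \<longleftrightarrow>
     (\<forall>G. open G \<longrightarrow> fsigma_in Z {z \<in> topspace Z. f z \<in> G})"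

text \<open>
  HOL cannot quantify over the type of points of \<open>Y\<close> inside a definition, so \<open>Y\<close> ranges over all
  topologies whose points are taken from the type \<^typ>\<open>'a \<Rightarrow> real\<close>. Nothing is lost:
  every separately continuous function factors through the evaluation map on the space of
  continuous functions on \<open>X\<close> with the topology of pointwise convergence, and the lemma
  \<open>L_property_all_types\<close> below derives the property for \<open>Y\<close> over an arbitrary type.
\<close>

definition L_property :: "'a topology \<Rightarrow> bool" where
  "L_property X \<longleftrightarrow>
     (\<forall>(Y :: ('a \<Rightarrow> real) topology) f.
        separately_continuous X Y f \<longrightarrow> first_Lebesgue_class (prod_topology X Y) f)"

lemma fsigma_in_continuous_preimage:
  assumes "continuous_map Z W h" "fsigma_in W S"
  shows "fsigma_in Z {z \<in> topspace Z. h z \<in> S}"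
proof -
  obtain C :: "nat \<Rightarrow> _" where C: "\<And>n. closedin W (C n)" "\<Union> (range C) = S"
    using assms(2) unfolding fsigma_in_ascending by blast
  have "{z \<in> topspace Z. h z \<in> S} = \<Union> (range (\<lambda>n. {z \<in> topspace Z. h z \<in> C n}))"
    using C(2) by auto
  also have "fsigma_in Z \<dots>"
    using closedin_continuous_map_preimage[OF assms(1) C(1)]
    by (intro fsigma_in_Union) (auto intro: closed_imp_fsigma_in)
  finally show ?thesis .
qed

lemma L_property_all_types:
  fixes X :: "'a topology" and Y :: "'b topology"
  assumes L: "L_property X" and f: "separately_continuous X Y f"
  shows "first_Lebesgue_class (prod_topology X Y) f"
proof -
  define C where "C = subtopology (product_topology (\<lambda>_. euclideanreal) (topspace X))
                        {g. continuous_map X euclideanreal g}"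
  define \<phi> where "\<phi> y = restrict (\<lambda>x. f (x, y)) (topspace X)" for y
  define ev :: "'a \<times> ('a \<Rightarrow> real) \<Rightarrow> real" where "ev = (\<lambda>(x, g). g x)"
  have "separately_continuous X C ev"
    unfolding separately_continuous_def C_def ev_def
    by (auto intro: continuous_map_from_subtopology continuous_map_product_projection)
  hence ev: "first_Lebesgue_class (prod_topology X C) ev"
    using L unfolding L_property_def by blast
  have "continuous_map X euclideanreal (\<phi> y)" if "y \<in> topspace Y" for y
  proof -
    have "continuous_map X euclideanreal (\<lambda>x. f (x, y))"
      using f that unfolding separately_continuous_def by blast
    thus ?thesis by (rule continuous_map_eq) (simp add: \<phi>_def)
  qed
  moreover have "continuous_map Y (product_topology (\<lambda>_. euclideanreal) (topspace X)) \<phi>"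
    using f unfolding continuous_map_componentwise separately_continuous_def
    by (auto simp: \<phi>_def)
  ultimately have \<phi>: "continuous_map Y C \<phi>"
    unfolding C_def by (auto intro: continuous_map_into_subtopology)
  define h :: "'a \<times> 'b \<Rightarrow> 'a \<times> ('a \<Rightarrow> real)" where "h = (\<lambda>(x, y). (x, \<phi> y))"
  have h: "continuous_map (prod_topology X Y) (prod_topology X C) h"
    unfolding h_def using \<phi>
    by (simp add: continuous_map_prod_top)
  show ?thesis
    unfolding first_Lebesgue_class_def
  proof (intro allI impI)
    fix G :: "real set"
    assume G: "open G"
    have "{z \<in> topspace (prod_topology X Y). f z \<in> G} =
          {z \<in> topspace (prod_topology X Y).
             h z \<in> {w \<in> topspace (prod_topology X C). ev w \<in> G}}"
      using continuous_map_funspace[OF h] by (auto simp: h_def ev_def \<phi>_def Pi_iff)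
    also have "fsigma_in (prod_topology X Y) \<dots>"
      using ev G h unfolding first_Lebesgue_class_def
      by (intro fsigma_in_continuous_preimage) auto
    finally show "fsigma_in (prod_topology X Y)
                    {z \<in> topspace (prod_topology X Y). f z \<in> G}" .
  qed
qed


section \<open>Baire spaces\<close>

definition dense_in :: "'a topology \<Rightarrow> 'a set \<Rightarrow> bool" where
  "dense_in X D \<longleftrightarrow> D \<subseteq> topspace X \<and> X closure_of D = topspace X"

text \<open>The intersection is taken inside \<^term>\<open>topspace X\<close> to account for the empty family.\<close>

definition Baire_space :: "'a topology \<Rightarrow> bool" where
  "Baire_space X \<longleftrightarrow>
     (\<forall>\<G>. countable \<G> \<and> (\<forall>G\<in>\<G>. openin X G \<and> dense_in X G)
           \<longrightarrow> dense_in X (topspace X \<inter> \<Inter>\<G>))"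


section \<open>Souslin number and density\<close>

definition souslin_bound :: "'a topology \<Rightarrow> 'c rel \<Rightarrow> bool" where
  "souslin_bound X \<kappa> \<longleftrightarrow>
     Card_order \<kappa> \<and> natLeq \<le>o \<kappa> \<and>
     (\<forall>\<U>. (\<forall>U\<in>\<U>. openin X U) \<and> pairwise disjnt \<U> \<longrightarrow> |\<U>| \<le>o \<kappa>)"

definition density_bound :: "'a topology \<Rightarrow> 'c rel \<Rightarrow> bool" where
  "density_bound X \<kappa> \<longleftrightarrow>
     Card_order \<kappa> \<and> natLeq \<le>o \<kappa> \<and> (\<exists>D. dense_in X D \<and> |D| \<le>o \<kappa>)"

text \<open>
  A cardinal is represented by a cardinal order, unique only up to the order isomorphism \<open>=o\<close>.
  The type \<^typ>\<open>'a + nat\<close> is merely a place large enough to realise the two minimal cardinals.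
  That they exist, and are minimal among the cardinals over all types, is proved below.
\<close>

definition souslin_number :: "'a topology \<Rightarrow> ('a + nat) rel" where
  "souslin_number X =
     (SOME \<kappa>. souslin_bound X \<kappa> \<and> (\<forall>\<mu> :: ('a + nat) rel. souslin_bound X \<mu> \<longrightarrow> \<kappa> \<le>o \<mu>))"

definition density_number :: "'a topology \<Rightarrow> ('a + nat) rel" where
  "density_number X =
     (SOME \<kappa>. density_bound X \<kappa> \<and> (\<forall>\<mu> :: ('a + nat) rel. density_bound X \<mu> \<longrightarrow> \<kappa> \<le>o \<mu>))"

lemma least_cardinal_exists:
  fixes P :: "'c rel \<Rightarrow> bool"
  assumes "P \<kappa>0" and card: "\<And>\<kappa>. P \<kappa> \<Longrightarrow> Card_order \<kappa>"
  shows "\<exists>\<kappa>. P \<kappa> \<and> (\<forall>\<mu>. P \<mu> \<longrightarrow> \<kappa> \<le>o \<mu>)"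
proof -
  have "{\<kappa>. P \<kappa>} \<noteq> {}" "\<forall>\<kappa> \<in> {\<kappa>. P \<kappa>}. Card_order \<kappa>"
    using assms by auto
  from exists_minim_Card_order[OF this] show ?thesis by simp
qed

lemma least_cardinal_all_types:
  fixes \<kappa> :: "'c rel" and \<mu> :: "'d rel"
  assumes "Card_order \<kappa>" "Card_order \<mu>"
    and least: "\<And>\<nu> :: 'c rel. Card_order \<nu> \<Longrightarrow> \<mu> =o \<nu> \<Longrightarrow> \<kappa> \<le>o \<nu>"
  shows "\<kappa> \<le>o \<mu>"
proof (rule ccontr)
  assume "\<not> \<kappa> \<le>o \<mu>"
  hence "\<mu> <o \<kappa>"
    using ordLess_or_ordLeq[OF card_order_on_well_order_on[OF assms(2)]
        card_order_on_well_order_on[OF assms(1)]] by simp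
  hence "\<exists>\<nu>. Field \<nu> < Field \<kappa> \<and> \<mu> =o \<nu> \<and> \<nu> <o \<kappa>"
    by (rule internalize_ordLess[THEN iffD1])
  then obtain \<nu> :: "'c rel" where \<nu>: "\<mu> =o \<nu>" "\<nu> <o \<kappa>"
    by (elim exE conjE)
  have "Card_order \<nu>"
    by (rule Card_order_ordIso2[OF assms(2) \<nu>(1)])
  from least[OF this \<nu>(1)] \<nu>(2) show False
    by (simp add: not_ordLess_ordLeq)
qed

lemma natLeq_ordLeq_card_of_sum_nat: "natLeq \<le>o |UNIV :: ('a + nat) set|"
proof -
  have "|UNIV :: nat set| \<le>o |UNIV :: ('a + nat) set|"
    by (rule card_of_ordLeqI[of Inr]) auto
  thus ?thesis
    by (rule ordIso_ordLeq_trans[OF ordIso_symmetric[OF card_of_nat]])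
qed

lemma souslin_bound_UNIV: "souslin_bound (X :: 'a topology) |UNIV :: ('a + nat) set|"
proof -
  have "|\<U>| \<le>o |UNIV :: ('a + nat) set|" if "pairwise disjnt \<U>" for \<U> :: "'a set set"
  proof (rule card_of_ordLeqI)
    show "inj_on (\<lambda>U. if U = {} then Inr 0 else Inl (SOME x. x \<in> U) :: 'a + nat) \<U>"
    proof (rule inj_onI)
      fix U V
      assume UV: "U \<in> \<U>" "V \<in> \<U>"
        and eq: "(if U = {} then Inr 0 else Inl (SOME x. x \<in> U) :: 'a + nat) =
                 (if V = {} then Inr 0 else Inl (SOME x. x \<in> V))"
      show "U = V"
      proof (cases "U = {} \<or> V = {}")
        case True
        thus ?thesis using eq by (auto split: if_splits)
      next
        case False
        hence "(SOME x. x \<in> U) \<in> U" "(SOME x. x \<in> V) \<in> V"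
          by (simp_all add: some_in_eq)
        with False eq have "\<not> disjnt U V"
          by (auto simp: disjnt_iff)
        thus ?thesis using that UV by (auto simp: pairwise_def)
      qed
    qed
  qed simp
  thus ?thesis
    unfolding souslin_bound_def by (simp add: natLeq_ordLeq_card_of_sum_nat card_of_Card_order)
qed

lemma density_bound_UNIV: "density_bound (X :: 'a topology) |UNIV :: ('a + nat) set|"
proof -
  have "|topspace X| \<le>o |UNIV :: ('a + nat) set|"
    by (rule card_of_ordLeqI[of Inl]) auto
  moreover have "dense_in X (topspace X)"
    by (simp add: dense_in_def)
  ultimately show ?thesis
    unfolding density_bound_def
    by (intro conjI exI) (simp_all add: natLeq_ordLeq_card_of_sum_nat card_of_Card_order)
qed

lemma souslin_number:
  "souslin_bound X (souslin_number X)"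
  "souslin_bound X (\<mu> :: ('a + nat) rel) \<Longrightarrow> souslin_number (X :: 'a topology) \<le>o \<mu>"
proof -
  have "\<exists>\<kappa> :: ('a + nat) rel. souslin_bound X \<kappa> \<and> (\<forall>\<mu> :: ('a + nat) rel. souslin_bound X \<mu> \<longrightarrow> \<kappa> \<le>o \<mu>)"
    by (rule least_cardinal_exists[where P = "souslin_bound X :: ('a + nat) rel \<Rightarrow> bool", OF souslin_bound_UNIV]) (simp add: souslin_bound_def)
  from someI_ex[OF this] show "souslin_bound X (souslin_number X)"
    "souslin_bound X (\<mu> :: ('a + nat) rel) \<Longrightarrow> souslin_number X \<le>o \<mu>"
    unfolding souslin_number_def by blast+
qed

lemma density_number:
  "density_bound X (density_number X)"
  "density_bound X (\<mu> :: ('a + nat) rel) \<Longrightarrow> density_number (X :: 'a topology) \<le>o \<mu>"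
proof -
  have "\<exists>\<kappa> :: ('a + nat) rel. density_bound X \<kappa> \<and> (\<forall>\<mu> :: ('a + nat) rel. density_bound X \<mu> \<longrightarrow> \<kappa> \<le>o \<mu>)"
    by (rule least_cardinal_exists[where P = "density_bound X :: ('a + nat) rel \<Rightarrow> bool", OF density_bound_UNIV]) (simp add: density_bound_def)
  from someI_ex[OF this] show "density_bound X (density_number X)"
    "density_bound X (\<mu> :: ('a + nat) rel) \<Longrightarrow> density_number X \<le>o \<mu>"
    unfolding density_number_def by blast+
qed

lemma souslin_number_least:
  fixes \<mu> :: "'c rel"
  assumes "souslin_bound X \<mu>"
  shows "souslin_number X \<le>o \<mu>"
proof (rule least_cardinal_all_types)
  fix \<nu> :: "('a + nat) rel"
  assume "Card_order \<nu>" "\<mu> =o \<nu>"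
  hence "souslin_bound X \<nu>"
    using assms unfolding souslin_bound_def by (simp, blast intro: ordLeq_ordIso_trans)
  thus "souslin_number X \<le>o \<nu>" by (rule souslin_number(2))
qed (use assms souslin_number(1)[of X] in \<open>auto simp: souslin_bound_def\<close>)

lemma density_least:
  fixes \<mu> :: "'c rel"
  assumes "density_bound X \<mu>"
  shows "density_number X \<le>o \<mu>"
proof (rule least_cardinal_all_types)
  fix \<nu> :: "('a + nat) rel"
  assume "Card_order \<nu>" "\<mu> =o \<nu>"
  hence "density_bound X \<nu>"
    using assms unfolding density_bound_def by (simp, blast intro: ordLeq_ordIso_trans)
  thus "density_number X \<le>o \<nu>" by (rule density_number(2))
qed (use assms density_number(1)[of X] in \<open>auto simp: density_bound_def\<close>)

end

(*
  Apply the L-property to the evaluation map on X x C(X), where C(X) carries the topology of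
  pointwise convergence: the set of pairs (x, g) with g x = 0 is an intersection of open sets G n.
  Since X x {0} lies in G n, around every point of X there are an open set U and a finite set A
  such that G n contains U x {g} for every g vanishing on A. A maximal disjoint family of such U
  has at most c(X) members and a dense union W n; let D collect the sets A of these families for
  all n. If g vanishes on D then (x, g) lies in every G n, i.e. g x = 0, for all x in the
  intersection of the W n, which is dense by the Baire property; so g = 0. By complete regularity
  D is dense.
*)

theory Submission
  imports Defs
begin

lemma dense_in_iff_meets_openin:
  "dense_in X D \<longleftrightarrow>
     D \<subseteq> topspace X \<and> (\<forall>W. openin X W \<and> W \<noteq> {} \<longrightarrow> W \<inter> D \<noteq> {})"
  unfolding dense_in_def dense_intersects_open by blast

lemma infinite_Field_if_natLeq_ordLeq:
  assumes "Card_order \<kappa>" "natLeq \<le>o \<kappa>"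
  shows "infinite (Field \<kappa>)"
  using ordLeq_ordIso_trans[OF assms(2) ordIso_symmetric[OF card_of_Field_ordIso[OF assms(1)]]]
    infinite_iff_natLeq_ordLeq by blast

lemma finite_card_of_ordLeq:
  assumes "natLeq \<le>o \<kappa>" "finite A"
  shows "|A| \<le>o \<kappa>"
  using ordLess_imp_ordLeq[OF assms(2)[unfolded finite_iff_ordLess_natLeq]] assms(1)
  by (rule ordLeq_transitive)

text \<open>Picking a point of the dense set from each nonempty member of a disjoint open family is
  injective. This gives c(X) \<le> d(X) for an arbitrary space.\<close>

lemma density_bound_imp_souslin_bound:
  assumes "density_bound X \<kappa>"
  shows "souslin_bound X \<kappa>"
proof -
  from assms obtain D where \<kappa>: "Card_order \<kappa>" "natLeq \<le>o \<kappa>"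
    and D: "dense_in X D" "|D| \<le>o \<kappa>"
    unfolding density_bound_def by blast
  have "|\<U>| \<le>o \<kappa>" if op: "\<forall>U\<in>\<U>. openin X U" and disj: "pairwise disjnt \<U>" for \<U>
  proof -
    define pick where "pick U = (SOME x. x \<in> U \<inter> D)" for U
    have pick: "pick U \<in> U \<inter> D" if "U \<in> \<U> - {{}}" for U
      unfolding pick_def
      using D(1) op that by (intro some_in_eq[THEN iffD2]) (auto simp: dense_in_iff_meets_openin)
    have "inj_on pick (\<U> - {{}})"
    proof (rule inj_onI)
      fix U V
      assume UV: "U \<in> \<U> - {{}}" "V \<in> \<U> - {{}}" "pick U = pick V"
      with pick[of U] pick[of V] have "\<not> disjnt U V"
        by (auto simp: disjnt_iff)
      with disj UV show "U = V"
        by (auto simp: pairwise_def)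
    qed
    hence "|\<U> - {{}}| \<le>o |D|"
      using pick by (intro card_of_ordLeqI[of pick]) auto
    hence "|\<U> - {{}}| \<le>o \<kappa>"
      using D(2) by (rule ordLeq_transitive)
    \<comment> \<open>A pairwise disjoint family may contain the empty set, where nothing can be
      picked; one extra element does not matter to an infinite cardinal.\<close>
    moreover have "|{{}} :: 'a set set| \<le>o \<kappa>"
      using \<kappa>(2) by (rule finite_card_of_ordLeq) simp
    ultimately have "|(\<U> - {{}}) \<union> {{}}| \<le>o \<kappa>"
      using \<kappa> by (intro card_of_Un_ordLeq_infinite_Field infinite_Field_if_natLeq_ordLeq)
    moreover have "|\<U>| \<le>o |(\<U> - {{}}) \<union> {{}}|"
      by (rule card_of_mono1) auto
    ultimately show ?thesis
      by (rule ordLeq_transitive[rotated])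
  qed
  with \<kappa> show ?thesis
    unfolding souslin_bound_def by blast
qed

text \<open>Zorn's lemma gives a maximal disjoint subfamily of \<open>\<P>\<close>. An open set
  missing its union would contain a nonempty member of \<open>\<P>\<close>, which could be
  added.\<close>

lemma disjoint_subfamily_dense_Union:
  assumes op: "\<And>U. U \<in> \<P> \<Longrightarrow> openin X U"
    and refine: "\<And>W. openin X W \<Longrightarrow> W \<noteq> {} \<Longrightarrow> \<exists>U\<in>\<P>. U \<noteq> {} \<and> U \<subseteq> W"
  obtains \<U> where "\<U> \<subseteq> \<P>" "pairwise disjnt \<U>" "dense_in X (\<Union>\<U>)"
proof -
  define \<A> where "\<A> = {\<U>. \<U> \<subseteq> \<P> \<and> pairwise disjnt \<U>}"
  have "\<exists>\<U>\<in>\<A>. \<forall>\<V>\<in>\<A>. \<U> \<subseteq> \<V> \<longrightarrow> \<V> = \<U>"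
  proof (rule subset_Zorn')
    fix \<C>
    assume "subset.chain \<A> \<C>"
    hence \<C>: "\<C> \<subseteq> \<A>" "\<And>\<U> \<V>. \<U> \<in> \<C> \<Longrightarrow> \<V> \<in> \<C> \<Longrightarrow> \<U> \<subseteq> \<V> \<or> \<V> \<subseteq> \<U>"
      by (auto simp: subset_chain_def)
    have "disjnt U V" if UV: "U \<in> \<Union>\<C>" "V \<in> \<Union>\<C>" "U \<noteq> V" for U V
    proof -
      obtain \<U> where "\<U> \<in> \<C>" "U \<in> \<U>" "V \<in> \<U>"
        using UV \<C>(2) by blast
      moreover from this(1) \<C>(1) have "pairwise disjnt \<U>"
        unfolding \<A>_def by blast
      ultimately show ?thesis
        using UV(3) by (simp add: pairwiseD)
    qed
    with \<C>(1) show "\<Union>\<C> \<in> \<A>"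
      by (auto simp: \<A>_def pairwise_def)
  qed
  then obtain \<U> where "\<U> \<in> \<A>" and maximal: "\<forall>\<V>\<in>\<A>. \<U> \<subseteq> \<V> \<longrightarrow> \<V> = \<U>"
    by (rule bexE)
  hence \<U>: "\<U> \<subseteq> \<P>" "pairwise disjnt \<U>"
    by (simp_all add: \<A>_def)
  have "W \<inter> \<Union>\<U> \<noteq> {}" if "openin X W" "W \<noteq> {}" for W
  proof
    assume W: "W \<inter> \<Union>\<U> = {}"
    from refine[OF that] obtain U where U: "U \<in> \<P>" "U \<noteq> {}" "U \<subseteq> W"
      by blast
    have "pairwise disjnt (insert U \<U>)"
      using \<U>(2) U(3) W by (auto simp: pairwise_insert disjnt_iff)
    hence "insert U \<U> \<in> \<A>"
      using \<U>(1) U(1) by (simp add: \<A>_def)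
    hence "insert U \<U> = \<U>"
      using maximal by blast
    with U W show False by blast
  qed
  moreover have "\<Union>\<U> \<subseteq> topspace X"
    using op \<U>(1) openin_subset by blast
  ultimately show ?thesis
    using that \<U> by (simp add: dense_in_iff_meets_openin)
qed

text \<open>This is C(X) with pointwise convergence. Points of the product are extensional outside
  \<open>topspace X\<close>, so a continuous function enters through its restriction; they have type
  \<open>'a \<Rightarrow> real\<close>, so \<open>L_property\<close> applies directly.\<close>

definition continuous_functions :: "'a topology \<Rightarrow> ('a \<Rightarrow> real) topology" where
  "continuous_functions X =
     subtopology (product_topology (\<lambda>_. euclideanreal) (topspace X))
       {g. continuous_map X euclideanreal g}"

text \<open>For fixed x evaluation is a coordinate projection; for fixed g it is g itself.\<close>

lemma separately_continuous_evaluation: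
  "separately_continuous X (continuous_functions X) (\<lambda>(x, g). g x)"
  unfolding separately_continuous_def continuous_functions_def
  by (auto intro: continuous_map_from_subtopology continuous_map_product_projection)

lemma topspace_continuous_functions:
  "topspace (continuous_functions X) =
     {g \<in> extensional (topspace X). continuous_map X euclideanreal g}"
  by (auto simp: continuous_functions_def PiE_def)

lemma restrict_in_continuous_functions:
  assumes "continuous_map X euclideanreal g"
  shows "restrict g (topspace X) \<in> topspace (continuous_functions X)"
  unfolding topspace_continuous_functions
  using assms continuous_map_eq[of X euclideanreal g "restrict g (topspace X)"] by simp

text \<open>By the L-property the preimage of the open set \<open>- {0}\<close> under evaluation is
  a countable union of closed sets; the \<open>G n\<close> are their complements.\<close>

lemma gdelta_in_zeros_evaluation:
  assumes "L_property X"
  obtains G :: "nat \<Rightarrow> ('a \<times> ('a \<Rightarrow> real)) set"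
  where "\<And>n. openin (prod_topology (X :: 'a topology) (continuous_functions X)) (G n)"
    and "(\<Inter>n. G n) = {(x, g). x \<in> topspace X \<and> g \<in> topspace (continuous_functions X) \<and> g x = 0}"
proof -
  let ?Z = "prod_topology X (continuous_functions X)"
  have "first_Lebesgue_class ?Z (\<lambda>(x, g). g x)"
    using assms separately_continuous_evaluation unfolding L_property_def by blast
  hence "fsigma_in ?Z {z \<in> topspace ?Z. (\<lambda>(x, g). g x) z \<in> - {0}}"
    unfolding first_Lebesgue_class_def by blast
  then obtain C :: "nat \<Rightarrow> _" where C: "\<And>n. closedin ?Z (C n)"
    and U: "\<Union> (range C) = {z \<in> topspace ?Z. (\<lambda>(x, g). g x) z \<in> - {0}}"
    unfolding fsigma_in_ascending by blast
  show ?thesis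
  proof (rule that)
    show "openin ?Z (topspace ?Z - C n)" for n
      using C by blast
    have "(\<Inter>n. topspace ?Z - C n) = topspace ?Z - \<Union> (range C)"
      by blast
    also have "\<dots> = {(x, g). x \<in> topspace X \<and> g \<in> topspace (continuous_functions X) \<and> g x = 0}"
      unfolding U by auto
    finally show "(\<Inter>n. topspace ?Z - C n) = \<dots>" .
  qed
qed

text \<open>A basic neighbourhood of the zero function restricts only finitely many coordinates.
  These form \<open>A\<close>, and a function vanishing on \<open>A\<close> cannot be told apart
  from zero there.\<close>

lemma openin_zero_section_nbhd:
  assumes "openin (prod_topology X (continuous_functions X)) G"
    and "(x, \<lambda>t\<in>topspace X. 0) \<in> G"
  obtains U A where "openin X U" "x \<in> U" "finite A" "A \<subseteq> topspace X"
    "\<And>x' g. x' \<in> U \<Longrightarrow> g \<in> topspace (continuous_functions X) \<Longrightarrow> \<forall>a\<in>A. g a = 0 \<Longrightarrow> (x', g) \<in> G"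
proof -
  let ?I = "topspace X" and ?z = "\<lambda>t\<in>topspace X. 0 :: real"
  obtain U V where U: "openin X U" "x \<in> U" and V: "openin (continuous_functions X) V" "?z \<in> V"
    and UV: "U \<times> V \<subseteq> G"
    using assms openin_prod_topology_alt by metis
  obtain T where T: "openin (product_topology (\<lambda>_. euclideanreal) ?I) T"
    and VT: "V = T \<inter> {g. continuous_map X euclideanreal g}"
    using V(1) unfolding continuous_functions_def openin_subtopology by blast
  obtain B where B: "finite {i \<in> ?I. B i \<noteq> UNIV}" "?z \<in> PiE ?I B" "PiE ?I B \<subseteq> T"
    using T V(2) unfolding openin_product_topology_alt VT by force
  show ?thesis
  proof (rule that[OF U B(1)])
    fix x' g
    assume g: "x' \<in> U" "g \<in> topspace (continuous_functions X)"
      "\<forall>a\<in>{i \<in> ?I. B i \<noteq> UNIV}. g a = 0"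
    have "g i \<in> B i" if "i \<in> ?I" for i
      using g(3) that PiE_mem[OF B(2), of i] by (cases "B i = UNIV") auto
    hence "g \<in> V"
      using g(2) B(3) by (auto simp: VT topspace_continuous_functions PiE_def)
    with g(1) UV show "(x', g) \<in> G" by blast
  qed auto
qed

lemma continuous_map_zero_on_dense:
  assumes "dense_in X D" "continuous_map X euclideanreal g" "\<And>x. x \<in> D \<Longrightarrow> g x = 0"
    and "x \<in> topspace X"
  shows "g x = 0"
proof (rule ccontr)
  assume "g x \<noteq> 0"
  moreover have "openin X {x \<in> topspace X. g x \<in> - {0}}"
    using assms(2) by (rule openin_continuous_map_preimage) auto
  ultimately show False
    using assms(1,3,4) unfolding dense_in_iff_meets_openin by blast
qed

text \<open>A point outside the closure of \<open>D\<close> would be separated from it by a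
  continuous function that is 0 on \<open>D\<close> and 1 at the point.\<close>

lemma dense_in_if_zero_on_imp_zero:
  assumes "completely_regular_space X" "D \<subseteq> topspace X"
    and zero: "\<And>g x. g \<in> topspace (continuous_functions X) \<Longrightarrow> \<forall>a\<in>D. g a = 0
                 \<Longrightarrow> x \<in> topspace X \<Longrightarrow> g x = 0"
  shows "dense_in X D"
proof (rule ccontr)
  assume "\<not> dense_in X D"
  then obtain x where x: "x \<in> topspace X - X closure_of D"
    using assms(2) closure_of_subset_topspace[of X D] by (auto simp: dense_in_def)
  obtain f :: "'a \<Rightarrow> real" where f: "continuous_map X euclideanreal f" "f x = 1"
    "f ` (X closure_of D) \<subseteq> {0}"
    using completely_regular_space_gen_alt[of "1::real" 0 X] assms(1) x
      closedin_closure_of[of X D]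
    by (metis zero_neq_one)
  have "f a = 0" if "a \<in> D" for a
    using that f(3) closure_of_subset[OF assms(2)] by auto
  hence "restrict f (topspace X) x = 0"
    using assms(2) x by (intro zero restrict_in_continuous_functions f(1)) auto
  with f(2) x show False by simp
qed

text \<open>Formulated for every bound \<open>\<kappa>\<close>, not just the least one, so that d(X)
  \<le> c(X) follows from the minimality of the density alone.\<close>

lemma souslin_bound_imp_density_bound:
  fixes X :: "'a topology" and \<kappa> :: "'c rel"
  assumes "completely_regular_space X" "Baire_space X" "L_property X"
    and "souslin_bound X \<kappa>"
  shows "density_bound X \<kappa>"
proof -
  let ?Y = "continuous_functions X"
  have \<kappa>: "Card_order \<kappa>" "natLeq \<le>o \<kappa>"
    and c: "\<And>\<U>. \<forall>U\<in>\<U>. openin X U \<Longrightarrow> pairwise disjnt \<U> \<Longrightarrow> |\<U>| \<le>o \<kappa>"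
    using assms(4) unfolding souslin_bound_def by blast+
  obtain G where G: "\<And>n::nat. openin (prod_topology X ?Y) (G n)"
    and Int_G: "(\<Inter>n. G n) = {(x, g). x \<in> topspace X \<and> g \<in> topspace ?Y \<and> g x = 0}"
    using gdelta_in_zeros_evaluation[OF assms(3)] by blast
  \<comment> \<open>\<open>A\<close> is a finite certificate for \<open>U\<close>: vanishing on
    \<open>A\<close> forces \<open>U \<times> {g}\<close> into \<open>G n\<close>.\<close>
  define good where "good n U A \<longleftrightarrow> finite A \<and> A \<subseteq> topspace X \<and>
    (\<forall>x\<in>U. \<forall>g\<in>topspace ?Y. (\<forall>a\<in>A. g a = 0) \<longrightarrow> (x, g) \<in> G n)" for n U A
  let ?\<P> = "\<lambda>n. {U. openin X U \<and> (\<exists>A. good n U A)}"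
  have refine: "\<exists>U\<in>?\<P> n. U \<noteq> {} \<and> U \<subseteq> W" if W: "openin X W" "W \<noteq> {}" for n W
  proof -
    obtain x where x: "x \<in> W" "x \<in> topspace X"
      using W openin_subset by blast
    hence "(x, \<lambda>t\<in>topspace X. 0) \<in> (\<Inter>n. G n)"
      unfolding Int_G using restrict_in_continuous_functions[of X "\<lambda>_. 0"] by simp
    hence "(x, \<lambda>t\<in>topspace X. 0) \<in> G n" by blast
    from openin_zero_section_nbhd[OF G this] obtain U A
      where "openin X U" "x \<in> U" "good n U A"
      unfolding good_def by metis
    \<comment> \<open>Shrinking \<open>U\<close> keeps the certificate \<open>A\<close> valid, so
      certified sets occur inside every nonempty open \<open>W\<close>.\<close>
    hence "openin X (U \<inter> W)" "x \<in> U \<inter> W" "good n (U \<inter> W) A"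
      using W(1) x(1) by (auto simp: good_def)
    thus ?thesis by (intro bexI[of _ "U \<inter> W"]) auto
  qed
  have "\<exists>\<U>. \<U> \<subseteq> ?\<P> n \<and> pairwise disjnt \<U> \<and> dense_in X (\<Union>\<U>)" for n
  proof (rule disjoint_subfamily_dense_Union[of "?\<P> n" X])
    show "\<exists>U\<in>?\<P> n. U \<noteq> {} \<and> U \<subseteq> W" if "openin X W" "W \<noteq> {}" for W
      using that by (rule refine)
  qed (simp, iprover)
  hence "\<exists>\<U>. \<forall>n. \<U> n \<subseteq> ?\<P> n \<and> pairwise disjnt (\<U> n) \<and> dense_in X (\<Union>(\<U> n))"
    by (intro choice allI)
  then obtain \<U> where \<U>: "\<And>n. \<U> n \<subseteq> ?\<P> n"
    "\<And>n. pairwise disjnt (\<U> n)" "\<And>n. dense_in X (\<Union>(\<U> n))"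
    by iprover
  have \<U>_open: "openin X U" if "U \<in> \<U> n" for n U
    using subsetD[OF \<U>(1) that] by simp
  define A where "A n U = (SOME A. good n U A)" for n U
  have A: "good n U (A n U)" if "U \<in> \<U> n" for n U
    unfolding A_def using subsetD[OF \<U>(1) that] by (simp add: someI_ex)
  define D where "D = (\<Union>n. \<Union>U\<in>\<U> n. A n U)"
  have "|A n U| \<le>o \<kappa>" if "U \<in> \<U> n" for n U
    using A[OF that] \<kappa>(2) finite_card_of_ordLeq unfolding good_def by blast
  moreover have "|\<U> n| \<le>o \<kappa>" for n
    using \<U>(2) by (intro c ballI \<U>_open)
  moreover have "|UNIV :: nat set| \<le>o \<kappa>"
    using card_of_nat \<kappa>(2) by (rule ordIso_ordLeq_trans)
  \<comment> \<open>\<open>D\<close> is a union over countably many n of at most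
    \<open>\<kappa>\<close> finite sets, and \<open>\<kappa>\<close> is infinite.\<close>
  ultimately have "|D| \<le>o \<kappa>"
    unfolding D_def
    by (intro card_of_UNION_ordLeq_infinite_Field infinite_Field_if_natLeq_ordLeq \<kappa> ballI)
  moreover have "dense_in X D"
  proof (rule dense_in_if_zero_on_imp_zero[OF assms(1)])
    show "D \<subseteq> topspace X"
      unfolding D_def using A by (auto simp: good_def)
    fix g x
    assume g: "g \<in> topspace ?Y" "\<forall>a\<in>D. g a = 0" and x: "x \<in> topspace X"
    define W where "W = topspace X \<inter> \<Inter>(range (\<lambda>n. \<Union>(\<U> n)))"
    have "openin X (\<Union>(\<U> n))" for n
      by (intro openin_Union \<U>_open)
    hence "dense_in X W"
      unfolding W_def
      by (intro assms(2)[unfolded Baire_space_def, rule_format]) (simp add: \<U>(3))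
    \<comment> \<open>For each n the point lies in some member of \<open>\<U> n\<close>, whose
      certificate is part of \<open>D\<close>; hence the pair lies in every
      \<open>G n\<close>.\<close>
    moreover have "g x' = 0" if "x' \<in> W" for x'
    proof -
      have "(x', g) \<in> G n" for n
      proof -
        from that obtain U where U: "U \<in> \<U> n" "x' \<in> U"
          unfolding W_def by blast
        have "\<forall>a\<in>A n U. g a = 0"
          using g(2) U(1) unfolding D_def by blast
        with A[OF U(1)] U(2) g(1) show ?thesis
          unfolding good_def by blast
      qed
      hence "(x', g) \<in> (\<Inter>n. G n)" by blast
      thus ?thesis unfolding Int_G by blast
    qed
    ultimately show "g x = 0"
      using g(1) x continuous_map_zero_on_dense[of X W g x]
      by (simp add: topspace_continuous_functions)
  qed
  ultimately show ?thesis
    using \<kappa> unfolding density_bound_def by blast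
qed

theorem theorem2p1:
  fixes X :: "'a topology"
  assumes "completely_regular_space X"
    and "Baire_space X"
    and "L_property X"
  shows "souslin_number X =o density_number X"
  \<comment> \<open>Each of the two numbers is a bound of the other kind, so minimality yields both
    inequalities.\<close>
  using souslin_number_least[OF density_bound_imp_souslin_bound[OF density_number(1)]]
    density_least[OF souslin_bound_imp_density_bound[OF assms souslin_number(1)]]
  by (simp add: ordIso_iff_ordLeq)

end
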